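(* We have $A=\varphi A^--A^+$. Moreover \[ qA^-A^*-A^*A^-=I,\qquad qA^*A^+-A^+A^*=I,\qquad qA^+A^--A^-A^+=\frac{q^N I}{q-1}. \]
   Context: Let $q$ be a prime power, $GF(q)$ the field with $q$ elements, $N\ge 1$ an integer, and $\mathbf V$ an $N$-dimensional vector space over $GF(q)$. Let $X$ be the set of all subspaces of $\mathbf V$, ordered by inclusion (the projective geometry $L_N(q)$). For $y,z\in X$, $y$ covers $z$ means $z\subseteq y$ and $\dim y-\dim z=1$. ${\rm Mat}_X(\mathbb C)$ is the algebra of complex matrices with rows and columns indexed by $X$, with identity $I$. $A^*\in{\rm Mat}_X(\mathbb C)$ is the diagonal matrix with $(y,y)$-entry $q^{-\dim y}$. $R,L\in{\rm Mat}_X(\mathbb C)$: $R_{y,z}=1$ if $y$ covers $z$ and $0$ otherwise; $L_{y,z}=1$ if $z$ covers $y$ and $0$ otherwise. Fix a real number $\varphi>0$. The matrix $A\in{\rm Mat}_X(\mathbb C)$ has $(y,z)$-entry $1$ if $y$ covers $z$; $\varphi q^{\dim y}$ if $z$ covers $y$; $\frac{\varphi-1}{q-1}q^{\dim y}$ if $y=z$; and $0$ otherwise. Define \[ A^+=\frac{(A^* )^{-1}}{q-1}-R,\qquad A^-=\frac{(A^* )^{-1}}{q-1}+(A^* )^{-1}L . \] *)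

theory Defs
  imports "HOL-Analysis.Analysis"
begin

text \<open>
  The field GF(q) is an arbitrary finite field type \<open>'k\<close>, with \<open>q = CARD('k)\<close>, and the vector space
  is an arbitrary type \<open>'v\<close> with scalar multiplication \<open>smul\<close>, satisfying \<open>vector_space smul\<close>.

  Library matrices are indexed by types, whereas the set of subspaces depends on the parameter
  \<open>smul\<close>. The rows and columns are therefore indexed by a finite type \<open>'x\<close> together with a labelling
  \<open>S :: 'x \<Rightarrow> 'v set\<close> which is a bijection onto the set of all subspaces; the index \<open>y :: 'x\<close>
  stands for the subspace \<open>S y\<close>.
\<close>

definition labels_subspaces ::
  "('k::{field,finite} \<Rightarrow> 'v::ab_group_add \<Rightarrow> 'v) \<Rightarrow> ('x::finite \<Rightarrow> 'v set) \<Rightarrow> bool"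
  where "labels_subspaces smul S \<longleftrightarrow>
    bij_betw S UNIV {W. module.subspace smul W}"

definition covers ::
  "('k::{field,finite} \<Rightarrow> 'v::ab_group_add \<Rightarrow> 'v) \<Rightarrow> 'v set \<Rightarrow> 'v set \<Rightarrow> bool"
  where "covers smul y z \<longleftrightarrow>
    z \<subseteq> y \<and> int (vector_space.dim smul y) - int (vector_space.dim smul z) = 1"

definition Astar ::
  "('k::{field,finite} \<Rightarrow> 'v::ab_group_add \<Rightarrow> 'v) \<Rightarrow> ('x::finite \<Rightarrow> 'v set) \<Rightarrow> complex ^ 'x ^ 'x"
  where "Astar smul S = (\<chi> y z.
    if y = z then of_nat CARD('k) powi (- int (vector_space.dim smul (S y))) else 0)"

definition Rmat ::
  "('k::{field,finite} \<Rightarrow> 'v::ab_group_add \<Rightarrow> 'v) \<Rightarrow> ('x::finite \<Rightarrow> 'v set) \<Rightarrow> complex ^ 'x ^ 'x"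
  where "Rmat smul S = (\<chi> y z. if covers smul (S y) (S z) then 1 else 0)"

definition Lmat ::
  "('k::{field,finite} \<Rightarrow> 'v::ab_group_add \<Rightarrow> 'v) \<Rightarrow> ('x::finite \<Rightarrow> 'v set) \<Rightarrow> complex ^ 'x ^ 'x"
  where "Lmat smul S = (\<chi> y z. if covers smul (S z) (S y) then 1 else 0)"

definition Amat ::
  "('k::{field,finite} \<Rightarrow> 'v::ab_group_add \<Rightarrow> 'v) \<Rightarrow> ('x::finite \<Rightarrow> 'v set) \<Rightarrow> real \<Rightarrow> complex ^ 'x ^ 'x"
  where "Amat smul S \<phi> = (\<chi> y z.
    if covers smul (S y) (S z) then 1
    else if covers smul (S z) (S y) then
      of_real \<phi> * of_nat CARD('k) ^ vector_space.dim smul (S y)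
    else if y = z then
      (of_real \<phi> - 1) / (of_nat CARD('k) - 1) * of_nat CARD('k) ^ vector_space.dim smul (S y)
    else 0)"

definition Aplus ::
  "('k::{field,finite} \<Rightarrow> 'v::ab_group_add \<Rightarrow> 'v) \<Rightarrow> ('x::finite \<Rightarrow> 'v set) \<Rightarrow> complex ^ 'x ^ 'x"
  where "Aplus smul S =
    (1 / (real CARD('k) - 1)) *\<^sub>R matrix_inv (Astar smul S) - Rmat smul S"

definition Aminus ::
  "('k::{field,finite} \<Rightarrow> 'v::ab_group_add \<Rightarrow> 'v) \<Rightarrow> ('x::finite \<Rightarrow> 'v set) \<Rightarrow> complex ^ 'x ^ 'x"
  where "Aminus smul S =
    (1 / (real CARD('k) - 1)) *\<^sub>R matrix_inv (Astar smul S)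
      + matrix_inv (Astar smul S) ** Lmat smul S"

end

theory Submission
  imports Defs
begin

text \<open>
  Let \<open>K\<close> be the inverse of \<open>A\<^sup>*\<close>. The first three identities hold entrywise because \<open>R\<close> raises and
  \<open>L\<close> lowers the dimension by one. In the last one the terms linear in \<open>R\<close> and \<open>L\<close> cancel for the
  same reason, leaving \<open>K\<^sup>2 / (q - 1) + K L R - q R K L = q\<^sup>N / (q - 1) I\<close>. Off the diagonal, two distinct
  subspaces have a (unique) common upper cover iff they have a (unique) common lower cover.
  On the diagonal, a subspace of dimension \<open>d\<close> has \<open>(q\<^sup>N\<^sup>-\<^sup>d - 1) / (q - 1)\<close> upper and
  \<open>(q\<^sup>d - 1) / (q - 1)\<close> lower covers.
\<close>

lemma two_le_CARD_field: "2 \<le> CARD('k::{field,finite})"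
proof -
  have "card {0, 1 :: 'k} \<le> CARD('k)"
    by (rule card_mono) auto
  then show ?thesis by simp
qed

lemma card_le_1_eqI:
  assumes "finite A" "finite B"
    and "\<And>x y. x \<in> A \<Longrightarrow> y \<in> A \<Longrightarrow> x = y" "\<And>x y. x \<in> B \<Longrightarrow> y \<in> B \<Longrightarrow> x = y"
    and "A = {} \<longleftrightarrow> B = {}"
  shows "card A = card B"
proof (cases "A = {}")
  case False
  then obtain a b where "a \<in> A" "b \<in> B" using assms(5) by blast
  then have "A = {a}" "B = {b}" using assms(3,4) by blast+
  then show ?thesis by simp
qed (use assms(5) in simp)

section \<open>Counting vectors in spans and subspaces\<close>

locale finite_vector_space = finite_dimensional_vector_space scale Basis
  for scale :: "'k::{field,finite} \<Rightarrow> 'v::ab_group_add \<Rightarrow> 'v" and Basis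
begin

text \<open>Since \<open>a\<close> lies outside \<open>span S\<close>, every vector of the larger
  span is \<open>scale c a + x\<close> for exactly one scalar \<open>c\<close> and one
  \<open>x\<close> in \<open>span S\<close>.\<close>

lemma card_span_insert:
  assumes "a \<notin> span S"
  shows "card (span (insert a S)) = CARD('k) * card (span S)"
proof -
  have "bij_betw (\<lambda>(c, x). scale c a + x) (UNIV \<times> span S) (span (insert a S))"
  proof (rule bij_betw_imageI)
    show "inj_on (\<lambda>(c, x). scale c a + x) (UNIV \<times> span S)"
    proof (rule inj_onI, clarify)
      fix c x d y
      assume xy: "x \<in> span S" "y \<in> span S" and eq: "scale c a + x = scale d a + y"
      have "scale (c - d) a = y - x"
        using eq by (simp add: scale_left_diff_distrib algebra_simps)
      then have mem: "scale (c - d) a \<in> span S"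
        using xy by (simp add: span_diff)
      have "c = d"
      proof (rule ccontr)
        assume "c \<noteq> d"
        then have "a = scale (inverse (c - d)) (scale (c - d) a)" by simp
        then show False using span_scale[OF mem] assms by metis
      qed
      then show "c = d \<and> x = y" using eq by simp
    qed
    show "(\<lambda>(c, x). scale c a + x) ` (UNIV \<times> span S) = span (insert a S)"
    proof (intro equalityI subsetI)
      fix v assume "v \<in> (\<lambda>(c, x). scale c a + x) ` (UNIV \<times> span S)"
      then show "v \<in> span (insert a S)"
        by (auto intro!: span_add span_scale span_base[of a]
            intro: span_mono[THEN subsetD, of S])
    next
      fix v assume "v \<in> span (insert a S)"
      then obtain c where "v - scale c a \<in> span S" by (auto simp: span_breakdown_eq)
      then show "v \<in> (\<lambda>(c, x). scale c a + x) ` (UNIV \<times> span S)"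
        by (intro image_eqI[of _ _ "(c, v - scale c a)"]) auto
    qed
  qed
  from bij_betw_same_card[OF this] show ?thesis
    by (simp add: card_cartesian_product)
qed

lemma card_subspace:
  assumes "subspace W"
  shows "card W = CARD('k) ^ dim W"
proof -
  obtain B where B: "B \<subseteq> W" "independent B" "W \<subseteq> span B" "card B = dim W"
    using basis_exists by blast
  have "card (span B) = CARD('k) ^ card B"
    using finiteI_independent[OF B(2)] B(2)
  proof (induction B)
    case (insert a B)
    then show ?case by (simp add: independent_insert card_span_insert)
  qed simp
  then show ?thesis using B span_subspace[OF B(1,3) assms] by simp
qed

text \<open>An infinite set has \<open>card\<close> 0, so the positive value given by
  \<open>card_subspace\<close> forces the whole space to be finite.\<close>

lemma finite_vectors [simp]: "finite (A :: 'v set)"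
proof -
  have "card (UNIV :: 'v set) = CARD('k) ^ dim UNIV"
    by (rule card_subspace) (rule subspace_UNIV)
  then have "finite (UNIV :: 'v set)"
    by (metis card_ge_0_finite zero_less_card_finite zero_less_power)
  then show ?thesis using finite_subset subset_UNIV by blast
qed

lemma finite_subspaces [simp]: "finite (F :: 'v set set)"
proof (rule finite_subset)
  show "F \<subseteq> Pow UNIV" by simp
  show "finite (Pow UNIV :: 'v set set)" by (simp only: finite_Pow_iff finite_vectors)
qed

section \<open>The covering relation and the counts of covers\<close>

lemma covers_iff: "covers scale y z \<longleftrightarrow> z \<subseteq> y \<and> dim y = Suc (dim z)"
  by (auto simp: covers_def)

lemma covers_span_insert:
  assumes "subspace T" "v \<notin> T"
  shows "covers scale (span (insert v T)) T"
  using assms span_superset[of "insert v T"]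
  by (auto simp: covers_iff dim_insert span_eq_iff[THEN iffD2])

lemma cover_eq_span_insert:
  assumes "subspace W" "subspace T" "covers scale W T" "v \<in> W" "v \<notin> T"
  shows "W = span (insert v T)"
proof (rule subspace_dim_equal[symmetric])
  show "span (insert v T) \<subseteq> W"
    using assms by (intro span_minimal) (auto simp: covers_iff)
  show "dim W \<le> dim (span (insert v T))"
    using assms covers_span_insert[OF assms(2,5)] by (simp add: covers_iff)
qed (use assms in simp_all)

text \<open>The sets \<open>W - T\<close>, for covers \<open>W\<close> of \<open>T\<close> inside
  \<open>Y\<close>, partition \<open>Y - T\<close>: a vector \<open>v\<close> of
  \<open>Y - T\<close> lies only in the cover \<open>span (insert v T)\<close>. Each piece has (q -
  1) q^(dim T) vectors. Integers avoid truncated subtraction, and the multiplied form avoids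
  division.\<close>

lemma card_covers_between:
  assumes "subspace T" "subspace Y" "T \<subseteq> Y"
  defines "C \<equiv> {W. subspace W \<and> W \<subseteq> Y \<and> covers scale W T}"
  shows "int (card C) * ((int CARD('k) - 1) * int CARD('k) ^ dim T)
    = int CARD('k) ^ dim Y - int CARD('k) ^ dim T"
proof -
  have diff: "int (card (W - T)) = int (card W) - int (card T)" if "T \<subseteq> W" for W
    using that by (simp add: card_Diff_subset card_mono of_nat_diff)
  have union: "Y - T = (\<Union>W\<in>C. W - T)"
  proof (intro equalityI subsetI)
    fix v assume v: "v \<in> Y - T"
    then have "span (insert v T) \<subseteq> Y"
      using assms(2,3) by (intro span_minimal) auto
    then have "span (insert v T) \<in> C"
      using v covers_span_insert[OF assms(1)] by (simp add: C_def)
    moreover have "v \<in> span (insert v T) - T"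
      using v by (simp add: span_base)
    ultimately show "v \<in> (\<Union>W\<in>C. W - T)" by blast
  qed (auto simp: C_def)
  have "card (Y - T) = (\<Sum>W\<in>C. card (W - T))"
    unfolding union
  proof (rule card_UN_disjoint)
    show "\<forall>W\<in>C. \<forall>W'\<in>C. W \<noteq> W' \<longrightarrow> (W - T) \<inter> (W' - T) = {}"
      using cover_eq_span_insert[OF _ assms(1)] unfolding C_def by blast
  qed auto
  then have "int (card (Y - T)) = (\<Sum>W\<in>C. int (card (W - T)))" by simp
  also have "\<dots> = (\<Sum>W\<in>C. (int CARD('k) - 1) * int CARD('k) ^ dim T)"
  proof (rule sum.cong)
    fix W assume "W \<in> C"
    then have "T \<subseteq> W" "subspace W" "dim W = Suc (dim T)"
      by (auto simp: C_def covers_iff)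
    then show "int (card (W - T)) = (int CARD('k) - 1) * int CARD('k) ^ dim T"
      by (simp add: diff card_subspace assms(1) algebra_simps)
  qed simp
  finally show ?thesis
    by (simp add: diff card_subspace assms(1-3))
qed

text \<open>One half of modularity. With \<open>w\<close> in \<open>W\<close> outside
  \<open>U\<close>, \<open>X\<close> is spanned by \<open>w\<close> and \<open>U\<close>. If
  \<open>v\<close> in \<open>W\<close> is a multiple of \<open>w\<close> plus some \<open>u\<close>
  in \<open>U\<close>, then \<open>u\<close> lies in \<open>W\<close> as well, so \<open>w\<close>
  and \<open>W \<inter> U\<close> span \<open>W\<close>.\<close>

lemma cover_Int:
  assumes "subspace W" "subspace U" "subspace X" "covers scale X W" "covers scale X U" "W \<noteq> U"
  shows "covers scale W (W \<inter> U)"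
proof -
  have "\<not> W \<subseteq> U"
    using assms subspace_dim_equal[of W U] by (auto simp: covers_iff)
  then obtain w where w: "w \<in> W" "w \<notin> U" by blast
  have X: "X = span (insert w U)"
    using w assms by (intro cover_eq_span_insert) (auto simp: covers_iff)
  have "W \<subseteq> span (insert w (W \<inter> U))"
  proof
    fix v assume v: "v \<in> W"
    then have "v \<in> span (insert w U)" using X assms(4) by (auto simp: covers_iff)
    then obtain c where "v - scale c w \<in> U"
      using assms(2) by (auto simp: span_breakdown_eq span_eq_iff[THEN iffD2])
    moreover have "v - scale c w \<in> W"
      using v w assms(1) by (simp add: subspace_diff subspace_scale)
    ultimately show "v \<in> span (insert w (W \<inter> U))"
      by (auto simp: span_breakdown_eq intro!: exI span_base)
  qed
  moreover have "span (insert w (W \<inter> U)) \<subseteq> W"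
    using w assms(1) by (intro span_minimal) auto
  ultimately have "W = span (insert w (W \<inter> U))" by blast
  moreover have "covers scale (span (insert w (W \<inter> U))) (W \<inter> U)"
    using w assms by (intro covers_span_insert subspace_inter) auto
  ultimately show ?thesis by simp
qed

text \<open>The other half of modularity: for \<open>w\<close> in \<open>W\<close> outside
  \<open>U\<close>, the space spanned by \<open>w\<close> and \<open>U\<close> contains
  \<open>W\<close>, because \<open>W\<close> is spanned by \<open>w\<close> and
  \<open>I\<close>.\<close>

lemma common_cover_exists:
  assumes "subspace W" "subspace U" "subspace I" "covers scale W I" "covers scale U I" "W \<noteq> U"
  shows "\<exists>X. subspace X \<and> covers scale X W \<and> covers scale X U"
proof -
  have "\<not> W \<subseteq> U"
    using assms subspace_dim_equal[of W U] by (auto simp: covers_iff)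
  then obtain w where w: "w \<in> W" "w \<notin> U" by blast
  have "W = span (insert w I)"
    using w assms by (intro cover_eq_span_insert) (auto simp: covers_iff)
  also have "\<dots> \<subseteq> span (insert w U)"
    using assms(5) by (intro span_mono) (auto simp: covers_iff)
  finally have "W \<subseteq> span (insert w U)" .
  moreover have "covers scale (span (insert w U)) U"
    by (rule covers_span_insert) (use assms w in auto)
  ultimately show ?thesis
    using assms(4,5) by (intro exI[of _ "span (insert w U)"]) (auto simp: covers_iff)
qed

text \<open>Any common cover contains a fixed \<open>w\<close> in \<open>W\<close> outside
  \<open>U\<close>, hence equals \<open>span (insert w U)\<close>.\<close>

lemma common_cover_unique:
  assumes "subspace W" "subspace U" "subspace X" "subspace Y" "W \<noteq> U"
    and "covers scale X W" "covers scale X U" "covers scale Y W" "covers scale Y U"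
  shows "X = Y"
proof -
  have "\<not> W \<subseteq> U"
    using assms subspace_dim_equal[of W U] by (auto simp: covers_iff)
  then obtain w where w: "w \<in> W" "w \<notin> U" by blast
  have "V = span (insert w U)" if "subspace V" "covers scale V W" "covers scale V U" for V
    by (rule cover_eq_span_insert) (use that w assms(2) in \<open>auto simp: covers_iff\<close>)
  then show ?thesis using assms by blast
qed

lemma card_common_covers:
  assumes "subspace W" "subspace U" "W \<noteq> U"
  shows "card {X. subspace X \<and> covers scale X W \<and> covers scale X U}
    = card {X. subspace X \<and> covers scale W X \<and> covers scale U X}"
    (is "card ?A = card ?B")
proof (rule card_le_1_eqI)
  show "X = Y" if "X \<in> ?A" "Y \<in> ?A" for X Y
    using that assms common_cover_unique by blast
  \<comment> \<open>Uniqueness read downwards: if \<open>X\<close> and \<open>Y\<close> were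
    distinct, \<open>W\<close> and \<open>U\<close> would be two common covers of them, forcing
    \<open>W = U\<close>.\<close>
  show "X = Y" if "X \<in> ?B" "Y \<in> ?B" for X Y
    using that assms common_cover_unique[of X Y W U] by blast
  have "?B \<noteq> {}" if "X \<in> ?A" for X
  proof -
    have "covers scale W (W \<inter> U)" "covers scale U (U \<inter> W)"
      using that assms cover_Int[of W U X] cover_Int[of U W X] by auto
    then have "W \<inter> U \<in> ?B" using assms by (simp add: Int_commute subspace_inter)
    then show ?thesis by blast
  qed
  moreover have "?A \<noteq> {}" if "X \<in> ?B" for X
    using that assms common_cover_exists[of W U X] by blast
  ultimately show "?A = {} \<longleftrightarrow> ?B = {}" by blast
qed simp_all

text \<open>Fix a hyperplane \<open>U\<close> of \<open>Y\<close>. Every other hyperplane \<open>W\<close> of \<open>Y\<close> meets \<open>U\<close> in a hyperplane \<open>T\<close> of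
  \<open>U\<close>, and each \<open>T\<close> arises from \<open>q\<close> such \<open>W\<close>, so the counts satisfy \<open>h (d + 1) = 1 + q * h d\<close>.\<close>

lemma card_hyperplanes:
  assumes "subspace Y"
  shows "int (card {W. subspace W \<and> covers scale Y W}) * (int CARD('k) - 1)
    = int CARD('k) ^ dim Y - 1"
  using assms
proof (induction "dim Y" arbitrary: Y)
  case 0
  then have "{W. subspace W \<and> covers scale Y W} = {}" by (auto simp: covers_iff simp del: dim_eq_0)
  then show ?case using 0(1)[symmetric] by (simp del: dim_eq_0)
next
  case (Suc d)
  let ?q = "int CARD('k)"
  define H where "H = (\<lambda>Y. {W. subspace W \<and> covers scale Y W})"
  define C where "C = (\<lambda>T. {W. subspace W \<and> W \<subseteq> Y \<and> covers scale W T})"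
  have "d \<le> dim Y" using Suc(2) by simp
  then obtain U where U: "subspace U" "U \<subseteq> span Y" "dim U = d"
    using choose_subspace_of_subspace by blast
  then have UY: "covers scale Y U"
    using Suc(2,3) by (metis covers_iff span_eq_iff)
  have decomp: "H Y = insert U (\<Union>T\<in>H U. C T - {U})"
  proof (intro equalityI subsetI)
    fix W assume W: "W \<in> H Y"
    show "W \<in> insert U (\<Union>T\<in>H U. C T - {U})"
    proof (cases "W = U")
      case False
      have "covers scale W (W \<inter> U)" "covers scale U (U \<inter> W)"
        using W False U UY Suc.prems cover_Int[of W U Y] cover_Int[of U W Y]
        by (auto simp: H_def)
      then have "W \<inter> U \<in> H U" "W \<in> C (W \<inter> U)"
        using W U by (auto simp: H_def C_def covers_iff Int_commute subspace_inter)
      then show ?thesis using False by blast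
    qed simp
  next
    fix W assume "W \<in> insert U (\<Union>T\<in>H U. C T - {U})"
    then show "W \<in> H Y"
      using U UY by (auto simp: H_def C_def covers_iff)
  qed
  \<comment> \<open>\<open>Y\<close> has dimension two above \<open>T\<close>, so
    \<open>q + 1\<close> subspaces lie strictly between them, and one of these is
    \<open>U\<close>.\<close>
  have cC: "int (card (C T - {U})) = ?q" if T: "T \<in> H U" for T
  proof -
    have T': "subspace T" "T \<subseteq> Y" "d = Suc (dim T)"
      using T U UY by (auto simp: H_def covers_iff)
    have "int (card (C T)) * ((?q - 1) * ?q ^ dim T) = ?q ^ dim Y - ?q ^ dim T"
      unfolding C_def by (rule card_covers_between) (use T' Suc.prems in auto)
    also have "\<dots> = (?q + 1) * ((?q - 1) * ?q ^ dim T)"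
      using T' Suc(2)[symmetric] by (simp add: algebra_simps)
    finally have "int (card (C T)) = ?q + 1"
      using two_le_CARD_field[where 'k='k] by simp
    moreover have "U \<in> C T"
      using T U UY by (auto simp: H_def C_def covers_iff)
    ultimately show ?thesis
      by (simp add: card_Diff_singleton)
  qed
  have "card (\<Union>T\<in>H U. C T - {U}) = (\<Sum>T\<in>H U. card (C T - {U}))"
  proof (rule card_UN_disjoint)
    show "\<forall>T\<in>H U. \<forall>T'\<in>H U. T \<noteq> T' \<longrightarrow> (C T - {U}) \<inter> (C T' - {U}) = {}"
    proof (intro ballI impI)
      fix T T' assume T: "T \<in> H U" "T' \<in> H U" "T \<noteq> T'"
      \<comment> \<open>Both \<open>W\<close> and \<open>U\<close> cover the distinct spaces
        \<open>T\<close> and \<open>T'\<close>, so they coincide.\<close>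
      have "W = U" if "W \<in> C T" "W \<in> C T'" for W
        using that T U(1) common_cover_unique[of T T' W U] unfolding H_def C_def by blast
      then show "(C T - {U}) \<inter> (C T' - {U}) = {}" by blast
    qed
  qed simp_all
  then have "int (card (H Y)) = 1 + (\<Sum>T\<in>H U. int (card (C T - {U})))"
    unfolding decomp by (subst card_insert_disjoint) auto
  also have "\<dots> = 1 + int (card (H U)) * ?q"
    by (simp add: cC)
  finally have "int (card (H Y)) * (?q - 1) = ?q - 1 + ?q * (int (card (H U)) * (?q - 1))"
    by (simp add: algebra_simps)
  also have "int (card (H U)) * (?q - 1) = ?q ^ d - 1"
    using Suc(1)[of U] U by (simp add: H_def)
  finally show ?case
    using Suc(2)[symmetric] by (simp add: H_def algebra_simps)
qed

text \<open>This is the (y,z)-entry of the remaining matrix identity in \<open>K\<close>,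
  \<open>R\<close> and \<open>L\<close>. In the lower-cover term the factor q times q^(dim y - 1)
  has been merged into q^(dim y).\<close>

lemma covers_balance:
  assumes "subspace y" "subspace z"
  shows "(if y = z then real CARD('k) ^ dim y * real CARD('k) ^ dim y / (real CARD('k) - 1) else 0)
      + real CARD('k) ^ dim y * real (card {X. subspace X \<and> covers scale X y \<and> covers scale X z})
      - real CARD('k) ^ dim y * real (card {X. subspace X \<and> covers scale y X \<and> covers scale z X})
    = (if y = z then real CARD('k) ^ dim UNIV / (real CARD('k) - 1) else 0)"
proof (cases "y = z")
  case True
  let ?q = "real CARD('k)"
  have q: "?q - 1 > 0" using two_le_CARD_field[where 'k='k] by simp
  let ?u = "real (card {X. subspace X \<and> covers scale X y})"
  let ?l = "real (card {X. subspace X \<and> covers scale y X})"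
  have "real_of_int (int (card {X. subspace X \<and> covers scale X y}) *
      ((int CARD('k) - 1) * int CARD('k) ^ dim y))
    = real_of_int (int CARD('k) ^ dim UNIV - int CARD('k) ^ dim y)"
    using card_covers_between[OF assms(1) subspace_UNIV] by simp
  then have u: "?u * (?q - 1) * ?q ^ dim y = ?q ^ dim UNIV - ?q ^ dim y"
    by (simp add: mult.assoc)
  have "real_of_int (int (card {X. subspace X \<and> covers scale y X}) * (int CARD('k) - 1))
    = real_of_int (int CARD('k) ^ dim y - 1)"
    using card_hyperplanes[OF assms(1)] by simp
  then have l: "?l * (?q - 1) = ?q ^ dim y - 1" by simp
  \<comment> \<open>After multiplication by q - 1, with d = dim y and N the dimension of the space,
    this reads q^(2d) + (q^N - q^d) - q^d (q^d - 1) = q^N.\<close>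
  have "?q ^ dim y * ?q ^ dim y + ?q ^ dim y * ?u * (?q - 1) - ?q ^ dim y * (?l * (?q - 1))
    = ?q ^ dim UNIV"
    unfolding l using u by (simp add: algebra_simps)
  then have "?q ^ dim y * ?q ^ dim y / (?q - 1) + ?q ^ dim y * ?u - ?q ^ dim y * ?l
    = ?q ^ dim UNIV / (?q - 1)"
    using q by (simp add: field_simps)
  then show ?thesis using True by simp
qed (use card_common_covers[OF assms] in simp)

end

section \<open>Matrix entries and the four identities\<close>

lemma matrix_inv_eqI:
  fixes A B :: "'a::field^'n^'n"
  assumes "A ** B = mat 1"
  shows "matrix_inv A = B"
proof -
  have BA: "B ** A = mat 1" using assms by (simp add: matrix_left_right_inverse)
  \<comment> \<open>\<open>matrix_inv\<close> is a Hilbert choice, so its properties need a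
    two-sided inverse as witness; \<open>B\<close> is one.\<close>
  have "A ** matrix_inv A = mat 1 \<and> matrix_inv A ** A = mat 1"
    unfolding matrix_inv_def by (rule someI[of _ B]) (use assms BA in simp)
  then have "B ** (A ** matrix_inv A) = B" by simp
  then show ?thesis by (simp add: matrix_mul_assoc BA)
qed

lemma matrix_inv_Astar:
  fixes smul :: "'k::{field,finite} \<Rightarrow> 'v::ab_group_add \<Rightarrow> 'v"
    and S :: "'x::finite \<Rightarrow> 'v set"
  shows "matrix_inv (Astar smul S)
    = (\<chi> y z. if y = z then of_nat CARD('k) ^ vector_space.dim smul (S y) else 0)"
  by (rule matrix_inv_eqI)
    (simp add: Astar_def matrix_matrix_mult_def mat_def vec_eq_iff mult_delta_left power_int_minus)

theorem lemma8p6: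
  fixes smul :: "'k::{field,finite} \<Rightarrow> 'v::ab_group_add \<Rightarrow> 'v"
    and S :: "'x::finite \<Rightarrow> 'v set"
    and q N :: nat
    and \<phi> :: real
  assumes "vector_space smul"
    and "q = CARD('k)"
    and "N \<ge> 1"
    and "vector_space.dim smul (UNIV :: 'v set) = N"
    and "labels_subspaces smul S"
    and "\<phi> > 0"
  shows "Amat smul S \<phi> = \<phi> *\<^sub>R Aminus smul S - Aplus smul S
    \<and> real q *\<^sub>R (Aminus smul S ** Astar smul S) - Astar smul S ** Aminus smul S = mat 1
    \<and> real q *\<^sub>R (Astar smul S ** Aplus smul S) - Aplus smul S ** Astar smul S = mat 1
    \<and> real q *\<^sub>R (Aplus smul S ** Aminus smul S) - Aminus smul S ** Aplus smul S
        = (real q ^ N / (real q - 1)) *\<^sub>R mat 1"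
proof -
  interpret vs: vector_space smul by fact
  obtain B where B: "vs.independent B" "vs.span B = vs.span UNIV" "card B = N"
    using assms(3,4) vs.basis_exists[of UNIV] by (metis vs.span_UNIV top.extremum_uniqueI)
  \<comment> \<open>The basis is finite because its cardinality \<open>N\<close> is
    positive.\<close>
  interpret finite_vector_space smul B
    using B assms(3) by unfold_locales (auto intro: card_ge_0_finite)
  define d where "d = (\<lambda>y. vs.dim (S y))"
  \<comment> \<open>\<open>r y z\<close> is the entry of R, and \<open>r z y\<close> that of its
    transpose L, so all products become sums of products of \<open>r\<close>.\<close>
  define r where "r = (\<lambda>y z. if covers smul (S y) (S z) then 1 else 0 :: complex)"
  define Q where "Q = (of_nat q :: complex)"
  have q2: "q \<ge> 2" using two_le_CARD_field[where 'k='k] assms(2) by simp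
  have Q0: "Q \<noteq> 0" "Q \<noteq> 1" "Q - 1 \<noteq> 0" using q2 by (auto simp: Q_def)
  have rE: "d y = Suc (d z)" if "r y z \<noteq> 0" for y z
    using that by (auto simp: r_def d_def covers_iff split: if_splits)
  \<comment> \<open>Entrywise form of K R = q R K; the factor \<open>r y z\<close> makes it hold for
    all pairs.\<close>
  have rd: "r y z * Q ^ d y = r y z * (Q * Q ^ d z)" for y z
    using rE[of y z] by (cases "r y z = 0") auto
  have Astar_entry: "Astar smul S $ y $ z = (if y = z then inverse (Q ^ d y) else 0)" for y z
    by (simp add: Astar_def power_int_minus d_def Q_def assms(2))
  have Aplus_entry: "Aplus smul S $ y $ z = (if y = z then Q ^ d y / (Q - 1) else 0) - r y z" for y z
    by (simp add: Aplus_def matrix_inv_Astar Rmat_def d_def Q_def r_def assms(2) scaleR_conv_of_real[where 'a=complex])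
  have Aminus_entry:
    "Aminus smul S $ y $ z = (if y = z then Q ^ d y / (Q - 1) else 0) + Q ^ d y * r z y" for y z
    by (simp add: Aminus_def matrix_inv_Astar Lmat_def d_def Q_def r_def assms(2) scaleR_conv_of_real[where 'a=complex]
        matrix_matrix_mult_def mult_delta_left)
  have inj: "inj S" and range: "range S = {W. vs.subspace W}"
    using assms(5) by (simp_all add: labels_subspaces_def bij_betw_def)
  have sub: "vs.subspace (S y)" for y
    using range by blast
  \<comment> \<open>The bijection \<open>S\<close> turns counts of indices into counts of
    subspaces.\<close>
  have card_labels: "card {w. P (S w)} = card {W. vs.subspace W \<and> P W}" for P
  proof -
    have "S ` {w. P (S w)} = {W. W \<in> range S \<and> P W}"
      by blast
    moreover have "inj_on S {w. P (S w)}"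
      using inj by (rule inj_on_subset) simp
    ultimately show ?thesis using card_image[of S "{w. P (S w)}"] by (simp add: range)
  qed
  have S_eq: "S y = S z \<longleftrightarrow> y = z" for y z
    using inj by (simp add: inj_eq)
  have up: "(\<Sum>w\<in>UNIV. r w y * r w z)
      = of_nat (card {X. vs.subspace X \<and> covers smul X (S y) \<and> covers smul X (S z)})" for y z
    unfolding card_labels[symmetric]
    by (simp add: r_def Collect_conj_eq flip: of_bool_def of_bool_conj)
  have down: "(\<Sum>w\<in>UNIV. r y w * r z w)
      = of_nat (card {X. vs.subspace X \<and> covers smul (S y) X \<and> covers smul (S z) X})" for y z
    unfolding card_labels[symmetric]
    by (simp add: r_def Collect_conj_eq flip: of_bool_def of_bool_conj)
  have balance: "(if y = z then Q ^ d y * Q ^ d y / (Q - 1) else 0)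
      + Q ^ d y * (\<Sum>w\<in>UNIV. r w y * r w z) - Q ^ d y * (\<Sum>w\<in>UNIV. r y w * r z w)
    = (if y = z then Q ^ N / (Q - 1) else 0)" for y z
    using arg_cong[OF covers_balance[OF sub sub, of y z], of complex_of_real] assms(2,4)
    by (simp add: up down Q_def d_def S_eq if_distrib cong: if_cong)
  define a where "a = (\<lambda>y. Q ^ d y / (Q - 1))"
  \<comment> \<open>The four summands come from expanding (D - R)(D + K L), where D is the diagonal
    matrix with entries \<open>a\<close>; \<open>mult_AA'\<close> expands the opposite
    product.\<close>
  have mult_AA: "(Aplus smul S ** Aminus smul S) $ y $ z
    = (if y = z then a y * a y else 0) + a y * (Q ^ d y * r z y) - r y z * a z
      - (\<Sum>w\<in>UNIV. r y w * (Q ^ d w * r z w))" for y z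
  proof -
    have "(Aplus smul S ** Aminus smul S) $ y $ z
      = (\<Sum>w\<in>UNIV. (if y = w then a w * ((if w = z then a w else 0) + Q ^ d w * r z w) else 0)
          - (if w = z then r y w * a w else 0) - r y w * (Q ^ d w * r z w))"
      unfolding matrix_matrix_mult_def
      by (simp, intro sum.cong) (auto simp: Aplus_entry Aminus_entry a_def algebra_simps)
    then show ?thesis by (simp add: sum_subtractf distrib_left)
  qed
  have mult_AA': "(Aminus smul S ** Aplus smul S) $ y $ z
    = (if y = z then a y * a y else 0) - a y * r y z + Q ^ d y * r z y * a z
      - Q ^ d y * (\<Sum>w\<in>UNIV. r w y * r w z)" for y z
  proof -
    have "(Aminus smul S ** Aplus smul S) $ y $ z
      = (\<Sum>w\<in>UNIV. (if y = w then a w * ((if w = z then a w else 0) - r w z) else 0)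
          + (if w = z then Q ^ d y * r w y * a w else 0) - Q ^ d y * (r w y * r w z))"
      unfolding matrix_matrix_mult_def
      by (simp, intro sum.cong) (auto simp: Aplus_entry Aminus_entry a_def algebra_simps)
    then show ?thesis
      by (simp add: sum_subtractf sum.distrib right_diff_distrib flip: sum_distrib_left)
  qed
  \<comment> \<open>A nonzero term has \<open>d y = Suc (d w)\<close>, so \<open>Q * Q ^ d w\<close>
    is the constant \<open>Q ^ d y\<close>.\<close>
  have down': "Q * (\<Sum>w\<in>UNIV. r y w * (Q ^ d w * r z w)) = Q ^ d y * (\<Sum>w\<in>UNIV. r y w * r z w)" for y z
    unfolding sum_distrib_left
  proof (rule sum.cong)
    show "Q * (r y w * (Q ^ d w * r z w)) = Q ^ d y * (r y w * r z w)" for w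
      using rE[of y w] by (cases "r y w = 0") auto
  qed simp
  have scale_q: "real q *\<^sub>R x = Q * x" for x :: complex
    by (simp add: scaleR_conv_of_real Q_def)
  have "Amat smul S \<phi> = \<phi> *\<^sub>R Aminus smul S - Aplus smul S"
  proof -
    have "Amat smul S \<phi> $ y $ z = (\<phi> *\<^sub>R Aminus smul S - Aplus smul S) $ y $ z" for y z
    proof -
      \<comment> \<open>The branches of \<open>Amat\<close> exclude one another, so the nested
        conditional can be compared with a sum of separate terms.\<close>
      have "\<not> covers smul (S y) (S y)" "\<not> (covers smul (S y) (S z) \<and> covers smul (S z) (S y))"
        by (auto simp: covers_iff)
      then show ?thesis
        by (auto simp: Amat_def Aminus_entry Aplus_entry r_def scaleR_conv_of_real[where 'a=complex]
            Q_def d_def assms(2) algebra_simps diff_divide_distrib)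
    qed
    then show ?thesis by (simp add: vec_eq_iff)
  qed
  moreover have "real q *\<^sub>R (Aminus smul S ** Astar smul S) - Astar smul S ** Aminus smul S = mat 1"
  proof -
    have "(Aminus smul S ** Astar smul S) $ y $ z = Aminus smul S $ y $ z * inverse (Q ^ d z)"
      "(Astar smul S ** Aminus smul S) $ y $ z = inverse (Q ^ d y) * Aminus smul S $ y $ z" for y z
      by (simp_all add: matrix_matrix_mult_def Astar_entry mult_delta_left mult_delta_right)
    \<comment> \<open>Off the diagonal a nonzero entry has \<open>d z = Suc (d y)\<close>, so the
      two terms cancel; on the diagonal (Q - 1) / (Q - 1) remains. For \<open>Aplus\<close> below,
      \<open>y\<close> and \<open>z\<close> swap roles.\<close>
    moreover have "Q * (Aminus smul S $ y $ z * inverse (Q ^ d z))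
        - inverse (Q ^ d y) * Aminus smul S $ y $ z = (if y = z then 1 else 0)" for y z
      using rE[of z y] Q0
      by (cases "r z y = 0") (auto simp: Aminus_entry field_simps)
    ultimately show ?thesis by (simp add: vec_eq_iff mat_def scale_q)
  qed
  moreover have "real q *\<^sub>R (Astar smul S ** Aplus smul S) - Aplus smul S ** Astar smul S = mat 1"
  proof -
    have "(Aplus smul S ** Astar smul S) $ y $ z = Aplus smul S $ y $ z * inverse (Q ^ d z)"
      "(Astar smul S ** Aplus smul S) $ y $ z = inverse (Q ^ d y) * Aplus smul S $ y $ z" for y z
      by (simp_all add: matrix_matrix_mult_def Astar_entry mult_delta_left mult_delta_right)
    moreover have "Q * (inverse (Q ^ d y) * Aplus smul S $ y $ z)
        - Aplus smul S $ y $ z * inverse (Q ^ d z) = (if y = z then 1 else 0)" for y z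
      using rE[of y z] Q0
      by (cases "r y z = 0") (auto simp: Aplus_entry field_simps)
    ultimately show ?thesis by (simp add: vec_eq_iff mat_def scale_q)
  qed
  moreover have "real q *\<^sub>R (Aplus smul S ** Aminus smul S) - Aminus smul S ** Aplus smul S
    = (real q ^ N / (real q - 1)) *\<^sub>R mat 1"
  proof -
    have "Q * (Aplus smul S ** Aminus smul S) $ y $ z - (Aminus smul S ** Aplus smul S) $ y $ z
      = (if y = z then Q ^ N / (Q - 1) else 0)" for y z
    proof -
      \<comment> \<open>These relations make both brackets linear in \<open>r\<close> vanish in the
        next display.\<close>
      have ra: "r y z * a y = Q * (r y z * a z)" "r z y * a z = Q * (r z y * a y)"
        using rd[of y z] rd[of z y] by (simp_all add: a_def field_simps)
      have "Q * (Aplus smul S ** Aminus smul S) $ y $ z - (Aminus smul S ** Aplus smul S) $ y $ z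
        = (if y = z then (Q - 1) * (a y * a y) else 0)
          + Q ^ d y * (Q * (r z y * a y) - r z y * a z) + (r y z * a y - Q * (r y z * a z))
          + Q ^ d y * (\<Sum>w\<in>UNIV. r w y * r w z) - Q * (\<Sum>w\<in>UNIV. r y w * (Q ^ d w * r z w))"
        unfolding mult_AA mult_AA' by (simp add: algebra_simps)
      also have "\<dots> = (if y = z then Q ^ d y * Q ^ d y / (Q - 1) else 0)
          + Q ^ d y * (\<Sum>w\<in>UNIV. r w y * r w z) - Q ^ d y * (\<Sum>w\<in>UNIV. r y w * r z w)"
        unfolding ra down' using Q0 by (simp add: a_def)
      finally show ?thesis by (simp only: balance)
    qed
    moreover have "(real q ^ N / (real q - 1)) *\<^sub>R x = Q ^ N / (Q - 1) * x" for x :: complex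
      by (simp add: scaleR_conv_of_real Q_def)
    ultimately show ?thesis
      by (simp add: vec_eq_iff mat_def scale_q)
  qed
  ultimately show ?thesis by blast
qed

end
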